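(* Let $0<\kappa<1$ and let $\Omega,\Omega^*\subset S^{n-1}$ be domains with $|\partial\Omega|=0$ and $x\cdot m\ge\kappa$ for all $x\in\Omega$, $m\in\Omega^*$. Let $m_1,\dots,m_N$ be distinct points in $\overline{\Omega^*}$, let $g_1,\dots,g_N$ be positive numbers, and let $f\in L^1(\Omega)$ be nonnegative, such that $x\cdot m_i\ge\kappa$ for $x\in\Omega$, $1\le i\le N$, and $$\int_{\overline\Omega}f(x)\,dx=\sum_{i=1}^Ng_i.$$ Then there exist positive numbers $b_1,b_2,\dots,b_N$ such that $\mathcal S=\{\rho(x)x:x\in\overline\Omega\}$ with $$\rho(x)=\min_{1\le i\le N}\frac{b_i}{1-\kappa\,m_i\cdot x}$$ is a weak solution to the far field refractor problem with emitting intensity $f$ and prescribed refracted intensity $\mu=\sum_{i=1}^Ng_i\delta_{m_i}$. Moreover, $\mathcal M_{\mathcal S,f}(\{m_i\})=g_i$ for $1\le i\le N$.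
   Context: $S^{n-1}$ is the unit sphere in $\mathbb R^n$ ($n\ge2$); $|\cdot|$ of subsets of the sphere and $dx$ refer to surface measure on the sphere. For $m\in\overline{\Omega^*}$, $b>0$, let $\rho(x,m,b)=\dfrac{b}{1-\kappa\,m\cdot x}$ (a semi-ellipsoid). A surface $\mathcal S=\{\rho(x)x:x\in\overline\Omega\}$ with $\rho>0$ continuous on $\overline\Omega$ is a far field refractor (for $\kappa<1$) if for each $x_0\in\overline\Omega$ there exist $m\in\overline{\Omega^*}$ and $b>0$ such that the semi-ellipsoid $\rho(\cdot,m,b)$ supports $\mathcal S$ at $\rho(x_0)x_0$, i.e. $\rho(x)\le\rho(x,m,b)$ for all $x\in\overline\Omega$ with equality at $x=x_0$. The far field refractor mapping is $$\mathcal N_{\mathcal S}(x_0)=\{m\in\overline{\Omega^*}:\rho(\cdot,m,b)\text{ supports }\mathcal S\text{ at }\rho(x_0)x_0\text{ for some }b>0\}.$$ For $F\subset\overline{\Omega^*}$, $\mathcal N_{\mathcal S}^{-1}(F)=\{x\in\overline\Omega:\mathcal N_{\mathcal S}(x)\cap F\ne\emptyset\}$ and $\mathcal M_{\mathcal S,f}(F)=\int_{\mathcal N_{\mathcal S}^{-1}(F)}f\,dx$, a Radon measure on $\overline{\Omega^*}$. A far field refractor $\mathcal S$ is a weak solution of the far field refractor problem with emitting intensity $f$ and prescribed refracted intensity $\mu$ on $\overline{\Omega^*}$ if $\mathcal M_{\mathcal S,f}(F)=\mu(F)$ for every Borel set $F\subset\overline{\Omega^*}$. *)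

theory Defs
  imports "HOL-Analysis.Analysis"
begin

section \<open>Surface measure on the unit sphere\<close>

text \<open>
  Surface measure on the unit sphere is given by polar coordinates: the measure of a Borel set
  \<open>A\<close> is \<open>n\<close> times the volume of the cone \<open>{r x | 0 < r < 1, x \<in> A}\<close>
  (see \<open>emeasure_sphere_borel_measure\<close> below).  It is completed, because for a far field
  refractor the sets on which the intensity is integrated are in general measurable only up to
  subsets of null sets.
\<close>

definition sphere_borel_measure :: "(real ^ 'n) measure" where
  "sphere_borel_measure =
     scale_measure (of_nat CARD('n))
       (distr (restrict_space lborel (ball 0 1 - {0}))
              (restrict_space borel (sphere 0 1))
              (\<lambda>y. y /\<^sub>R norm y))"

definition surface_measure :: "(real ^ 'n) measure" where
  "surface_measure = completion sphere_borel_measure"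

lemma sets_sphere_borel_measure:
  "sets (sphere_borel_measure :: (real ^ 'n) measure) = sets (restrict_space borel (sphere 0 1))"
  by (simp add: sphere_borel_measure_def)

lemma emeasure_sphere_borel_measure:
  fixes A :: "(real ^ 'n) set"
  assumes "A \<in> sets borel" "A \<subseteq> sphere 0 1"
  shows "emeasure sphere_borel_measure A =
           of_nat CARD('n) * emeasure lborel {r *\<^sub>R x | r x. 0 < r \<and> r < 1 \<and> x \<in> A}"
proof -
  let ?B = "ball 0 1 - {0 :: real ^ 'n}"
  let ?p = "\<lambda>y :: real ^ 'n. y /\<^sub>R norm y"
  have p: "?p \<in> restrict_space lborel ?B \<rightarrow>\<^sub>M restrict_space borel (sphere 0 1)"
    by (intro measurable_restrict_space2 measurable_restrict_space1)
       (auto simp: space_restrict_space)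
  have A: "A \<in> sets (restrict_space borel (sphere 0 1))"
    using assms by (auto simp: sets_restrict_space_iff)
  have eq: "?p -` A \<inter> ?B = {r *\<^sub>R x | r x. 0 < r \<and> r < 1 \<and> x \<in> A}" (is "_ = ?C")
  proof (intro set_eqI iffI)
    fix y assume "y \<in> ?p -` A \<inter> ?B"
    then have "y = norm y *\<^sub>R ?p y \<and> 0 < norm y \<and> norm y < 1 \<and> ?p y \<in> A"
      by auto
    then show "y \<in> ?C" by blast
  next
    fix y assume "y \<in> ?C"
    then obtain r x where "y = r *\<^sub>R x" "0 < r" "r < 1" "x \<in> A" by blast
    moreover from this have "norm x = 1" using assms by auto
    ultimately show "y \<in> ?p -` A \<inter> ?B" by auto
  qed
  have "emeasure (distr (restrict_space lborel ?B) (restrict_space borel (sphere 0 1)) ?p) A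
          = emeasure lborel (?p -` A \<inter> ?B)"
    using p A by (simp add: emeasure_distr space_restrict_space emeasure_restrict_space)
  then show ?thesis
    by (simp add: sphere_borel_measure_def eq)
qed

text \<open>
  Domains in the sphere. Since the sphere is closed, the closure of a subset relative to the
  sphere is its closure in the ambient space; the boundary has to be taken relative to the sphere.
\<close>

definition sphere_domain :: "(real ^ 'n) set \<Rightarrow> bool" where
  "sphere_domain U \<longleftrightarrow> openin (top_of_set (sphere 0 1)) U \<and> connected U \<and> U \<noteq> {}"

definition sphere_boundary :: "(real ^ 'n) set \<Rightarrow> (real ^ 'n) set" where
  "sphere_boundary U = top_of_set (sphere 0 1) frontier_of U"

section \<open>Far field refractors for \<open>\<kappa> < 1\<close>\<close>

text \<open>
  A surface \<open>{\<rho>(x) x | x \<in> closure \<Omega>}\<close> with positive \<open>\<rho>\<close> is represented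
  throughout by its radial function \<open>\<rho>\<close>, which it determines on \<open>closure \<Omega>\<close>; the values
  of \<open>\<rho>\<close> elsewhere play no role.  \<open>\<Omega>s\<close> is the target domain.
\<close>

definition semi_ellipsoid :: "real \<Rightarrow> real ^ 'n \<Rightarrow> real \<Rightarrow> real ^ 'n \<Rightarrow> real" where
  "semi_ellipsoid \<kappa> m b x = b / (1 - \<kappa> * (m \<bullet> x))"

definition supports_at ::
  "real \<Rightarrow> (real ^ 'n) set \<Rightarrow> (real ^ 'n \<Rightarrow> real) \<Rightarrow> real ^ 'n \<Rightarrow> real \<Rightarrow> real ^ 'n \<Rightarrow> bool" where
  "supports_at \<kappa> \<Omega> \<rho> m b x0 \<longleftrightarrow>
     (\<forall>x\<in>closure \<Omega>. \<rho> x \<le> semi_ellipsoid \<kappa> m b x) \<and> \<rho> x0 = semi_ellipsoid \<kappa> m b x0"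

definition far_field_refractor ::
  "real \<Rightarrow> (real ^ 'n) set \<Rightarrow> (real ^ 'n) set \<Rightarrow> (real ^ 'n \<Rightarrow> real) \<Rightarrow> bool" where
  "far_field_refractor \<kappa> \<Omega> \<Omega>s \<rho> \<longleftrightarrow>
     continuous_on (closure \<Omega>) \<rho> \<and> (\<forall>x\<in>closure \<Omega>. 0 < \<rho> x) \<and>
     (\<forall>x0\<in>closure \<Omega>. \<exists>m\<in>closure \<Omega>s. \<exists>b>0. supports_at \<kappa> \<Omega> \<rho> m b x0)"

definition refractor_mapping ::
  "real \<Rightarrow> (real ^ 'n) set \<Rightarrow> (real ^ 'n) set \<Rightarrow> (real ^ 'n \<Rightarrow> real) \<Rightarrow> real ^ 'n \<Rightarrow> (real ^ 'n) set" where
  "refractor_mapping \<kappa> \<Omega> \<Omega>s \<rho> x0 = {m \<in> closure \<Omega>s. \<exists>b>0. supports_at \<kappa> \<Omega> \<rho> m b x0}"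

definition refractor_preimage ::
  "real \<Rightarrow> (real ^ 'n) set \<Rightarrow> (real ^ 'n) set \<Rightarrow> (real ^ 'n \<Rightarrow> real) \<Rightarrow> (real ^ 'n) set \<Rightarrow> (real ^ 'n) set" where
  "refractor_preimage \<kappa> \<Omega> \<Omega>s \<rho> F =
     {x \<in> closure \<Omega>. refractor_mapping \<kappa> \<Omega> \<Omega>s \<rho> x \<inter> F \<noteq> {}}"

definition refractor_measure ::
  "real \<Rightarrow> (real ^ 'n) set \<Rightarrow> (real ^ 'n) set \<Rightarrow> (real ^ 'n \<Rightarrow> real) \<Rightarrow> (real ^ 'n \<Rightarrow> real) \<Rightarrow>
     (real ^ 'n) set \<Rightarrow> real" where
  "refractor_measure \<kappa> \<Omega> \<Omega>s \<rho> f F =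
     (LINT x:refractor_preimage \<kappa> \<Omega> \<Omega>s \<rho> F|surface_measure. f x)"

text \<open>
  The measurability of the preimage is part of the definition because the library's integral over
  a non-measurable set is a default value and carries no information.  Only the values of \<open>\<mu>\<close>
  on Borel subsets of \<open>closure \<Omega>s\<close> matter.
\<close>

definition weak_solution ::
  "real \<Rightarrow> (real ^ 'n) set \<Rightarrow> (real ^ 'n) set \<Rightarrow> (real ^ 'n \<Rightarrow> real) \<Rightarrow> (real ^ 'n) measure \<Rightarrow>
     (real ^ 'n \<Rightarrow> real) \<Rightarrow> bool" where
  "weak_solution \<kappa> \<Omega> \<Omega>s f \<mu> \<rho> \<longleftrightarrow>
     far_field_refractor \<kappa> \<Omega> \<Omega>s \<rho> \<and>
     (\<forall>F \<in> sets borel. F \<subseteq> closure \<Omega>s \<longrightarrow>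
        refractor_preimage \<kappa> \<Omega> \<Omega>s \<rho> F \<in> sets surface_measure \<and>
        ennreal (refractor_measure \<kappa> \<Omega> \<Omega>s \<rho> f F) = emeasure \<mu> F)"

section \<open>Finite sums of point masses\<close>

text \<open>The measure with mass \<open>g i\<close> at \<open>m i\<close> for each \<open>i \<in> I\<close>, as the image of the weighted
  counting measure on \<open>I\<close>.\<close>

definition point_masses :: "'i set \<Rightarrow> ('i \<Rightarrow> real) \<Rightarrow> ('i \<Rightarrow> real ^ 'n) \<Rightarrow> (real ^ 'n) measure" where
  "point_masses I g m = distr (point_measure I (\<lambda>i. ennreal (g i))) borel m"

lemma emeasure_point_masses:
  assumes "finite I" "F \<in> sets borel"
  shows "emeasure (point_masses I g m) F = (\<Sum>i\<in>I. ennreal (g i) * indicator F (m i))"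
proof -
  have "emeasure (point_masses I g m) F = (\<Sum>i\<in>m -` F \<inter> I. ennreal (g i))"
    unfolding point_masses_def using assms
    by (subst emeasure_distr) (auto simp: space_point_measure emeasure_point_measure_finite)
  also have "\<dots> = (\<Sum>i\<in>I. ennreal (g i) * indicator F (m i))"
    using assms by (intro sum.mono_neutral_cong_left) (auto simp: indicator_def)
  finally show ?thesis .
qed

end

theory Submission
  imports Defs
begin

text \<open>
  Put \<open>w i = 1 / b i\<close>. The reciprocal of the radial function is then the maximum of the functions
  \<open>w i * (1 - \<kappa> * (m i \<bullet> x))\<close>, and the point \<open>x\<close> is refracted into the direction \<open>m i\<close> whose function
  attains this maximum. Thus the sphere is divided into cells, one for each direction, and the
  weights have to be chosen so that the cell of \<open>m i\<close> receives the energy \<open>g i\<close>.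

  Such weights exist by a monotonicity and compactness argument (\<open>ex_weights\<close>). Fix \<open>w k = 1\<close> for one
  index \<open>k\<close> and consider the weights for which no other cell receives more than its share. They form
  a compact set, because the energies depend continuously on the weights, and because a very large
  weight would leave nothing to cell \<open>k\<close>, which must receive at least \<open>g k\<close>. Take weights with maximal
  sum. If some cell received less than its share, its weight could be increased a little: all
  other cells shrink, so the constraints persist, contradicting maximality. Hence all cells other
  than \<open>k\<close> receive exactly their shares, and cell \<open>k\<close> receives what remains, which is \<open>g k\<close>.

  Continuity and additivity of the energies rest on the fact that two of the functions agree only
  on a null set: the tie set is the section of the sphere by a hyperplane
  (\<open>AE_surface_measure_hyperplane\<close>).

  The refractor mapping of the surface could still take values other than the \<open>m i\<close>. At a point of
  \<open>\<Omega>\<close> in only one cell this does not happen, since two semi-ellipsoids that touch from one side at a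
  point are equal if both axes meet its direction with cosine at least \<open>\<kappa>\<close>
  (\<open>touching_ellipsoids_equal\<close>). So, up to a null set, the preimage of a set \<open>F\<close> of directions is
  the part in \<open>closure \<Omega>\<close> of the union of the cells with \<open>m i \<in> F\<close>.
\<close>

section \<open>Dividing a measure into cells of prescribed mass\<close>

text \<open>
  The index type is countable so that the space of weight functions is first countable, and
  continuity can be tested on sequences by dominated convergence.
\<close>

locale dominance_cells =
  fixes M :: "'a measure" and I :: "'i::countable set"
    and c :: "'i \<Rightarrow> 'a \<Rightarrow> real" and f :: "'a \<Rightarrow> real"
  assumes finite_I: "finite I"
    and c_measurable: "\<And>i. i \<in> I \<Longrightarrow> c i \<in> borel_measurable M"
    and c_pos: "\<And>i x. i \<in> I \<Longrightarrow> x \<in> space M \<Longrightarrow> 0 < c i x"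
    and ties_null: "\<And>i j s t. i \<in> I \<Longrightarrow> j \<in> I \<Longrightarrow> i \<noteq> j \<Longrightarrow> 0 < s \<Longrightarrow> 0 < t \<Longrightarrow>
                      AE x in M. s * c i x \<noteq> t * c j x"
    and f_integrable: "integrable M f"
    and f_nonneg: "AE x in M. 0 \<le> f x"
begin

definition cell :: "('i \<Rightarrow> real) \<Rightarrow> 'i \<Rightarrow> 'a set" where
  "cell w i = {x \<in> space M. \<forall>j\<in>I. w j * c j x \<le> w i * c i x}"

definition cell_mass :: "('i \<Rightarrow> real) \<Rightarrow> 'i \<Rightarrow> real" where
  "cell_mass w i = (LINT x:cell w i|M. f x)"

text \<open>
  Zero weights are admitted because the extremal argument takes place on a closed set of weights;
  one positive weight suffices for the maximum to be attained only at positive weights, where ties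
  are null.
\<close>

definition admissible :: "('i \<Rightarrow> real) \<Rightarrow> bool" where
  "admissible w \<longleftrightarrow> (\<forall>i\<in>I. 0 \<le> w i) \<and> (\<exists>i\<in>I. 0 < w i)"

lemma cell_measurable:
  assumes "i \<in> I"
  shows "cell w i \<in> sets M"
proof -
  have "{x \<in> space M. w j * c j x \<le> w i * c i x} \<in> sets M" if "j \<in> I" for j
    using that assms c_measurable by (intro borel_measurable_le) auto
  moreover have "cell w i = space M \<inter> (\<Inter>j\<in>I. {x \<in> space M. w j * c j x \<le> w i * c i x})"
    unfolding cell_def by auto
  ultimately show ?thesis
    using assms finite_I by (auto intro!: sets.Int sets.finite_INT)
qed

lemma set_integrable_f: "A \<in> sets M \<Longrightarrow> set_integrable M A f"
  unfolding set_integrable_def using integrable_mult_indicator[OF _ f_integrable] by auto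

lemma AE_strict_winner:
  assumes "admissible w"
  shows "AE x in M. \<exists>i\<in>I. \<forall>j\<in>I - {i}. w j * c j x < w i * c i x"
proof -
  have "AE x in M. \<forall>i\<in>I. \<forall>j\<in>I. i \<noteq> j \<longrightarrow> 0 < w i \<longrightarrow> 0 < w j \<longrightarrow> w i * c i x \<noteq> w j * c j x"
  proof (intro AE_finite_allI finite_I)
    fix i j assume ij: "i \<in> I" "j \<in> I"
    show "AE x in M. i \<noteq> j \<longrightarrow> 0 < w i \<longrightarrow> 0 < w j \<longrightarrow> w i * c i x \<noteq> w j * c j x"
    proof (cases "i \<noteq> j \<and> 0 < w i \<and> 0 < w j")
      case True
      then show ?thesis using ties_null[OF ij, of "w i" "w j"] by simp
    qed auto
  qed
  then show ?thesis
    using AE_space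
  proof eventually_elim
    case (elim x)
    obtain k where k: "k \<in> I" "0 < w k" using assms unfolding admissible_def by auto
    obtain i where i: "i \<in> I" "\<And>j. j \<in> I \<Longrightarrow> w j * c j x \<le> w i * c i x"
    proof -
      have "Max ((\<lambda>i. w i * c i x) ` I) \<in> (\<lambda>i. w i * c i x) ` I"
        using finite_I k by (intro Max_in) auto
      then obtain i where "i \<in> I" "Max ((\<lambda>i. w i * c i x) ` I) = w i * c i x" by auto
      moreover have "w j * c j x \<le> Max ((\<lambda>i. w i * c i x) ` I)" if "j \<in> I" for j
        using finite_I that by (intro Max_ge) auto
      ultimately show thesis using that by metis
    qed
    have *: "0 < w i * c i x"
      using i(2)[OF k(1)] mult_pos_pos[OF k(2) c_pos[OF k(1) elim(2)]] by simp
    have pos: "0 < w l" if l: "l \<in> I" "w l * c l x = w i * c i x" for l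
    proof -
      have "0 < w l * c l x" using * l(2) by simp
      then show ?thesis using c_pos[OF l(1) elim(2)] by (rule zero_less_mult_pos2)
    qed
    have "w j * c j x < w i * c i x" if j: "j \<in> I" "j \<noteq> i" for j
    proof -
      have "w j * c j x \<noteq> w i * c i x"
      proof
        assume eq: "w j * c j x = w i * c i x"
        then have "0 < w j" "0 < w i" using pos i(1) j(1) by auto
        then show False using elim(1) i(1) j eq by auto
      qed
      then show ?thesis using i(2)[OF j(1)] by simp
    qed
    then show ?case using i(1) by blast
  qed
qed

lemma cell_strict_winner:
  assumes "a \<in> I" "i \<in> I" "\<And>j. j \<in> I - {a} \<Longrightarrow> w j * c j x < w a * c a x"
  shows "x \<in> cell w i \<longleftrightarrow> x \<in> space M \<and> i = a"
proof (cases "i = a")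
  case True
  then show ?thesis using assms(1,3) unfolding cell_def by (force simp: less_imp_le)
next
  case False
  then have "\<not> w a * c a x \<le> w i * c i x" using assms by (simp add: not_le)
  then show ?thesis using False assms(1) unfolding cell_def by auto
qed

text \<open>The cells overlap only in ties, hence in a null set.\<close>

lemma cell_mass_UN:
  assumes "admissible w" "J \<subseteq> I"
  shows "(LINT x:(\<Union>i\<in>J. cell w i)|M. f x) = (\<Sum>i\<in>J. cell_mass w i)"
proof -
  have fin: "finite J" using assms finite_I finite_subset by blast
  have "(LINT x:(\<Union>i\<in>J. cell w i)|M. f x) = (\<integral>x. (\<Sum>i\<in>J. indicat_real (cell w i) x *\<^sub>R f x) \<partial>M)"
    unfolding set_lebesgue_integral_def
  proof (rule integral_cong_AE)
    show "AE x in M. indicat_real (\<Union>i\<in>J. cell w i) x *\<^sub>R f x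
                     = (\<Sum>i\<in>J. indicat_real (cell w i) x *\<^sub>R f x)"
      using AE_strict_winner[OF assms(1)]
    proof eventually_elim
      case (elim x)
      then obtain i where i: "i \<in> I" "\<And>j. j \<in> I - {i} \<Longrightarrow> w j * c j x < w i * c i x" by auto
      have out: "x \<notin> cell w j" if "j \<in> J" "j \<noteq> i" for j
        using cell_strict_winner[OF i(1) _ i(2), of j] that assms(2) by auto
      have "(\<Sum>j\<in>J. indicat_real (cell w j) x *\<^sub>R f x) =
            (\<Sum>j\<in>J. if j = i then indicat_real (cell w i) x * f x else 0)"
        using out by (intro sum.cong) (auto simp: indicator_def)
      also have "\<dots> = indicat_real (\<Union>i\<in>J. cell w i) x * f x"
        using fin out by (auto simp: indicator_def)
      finally show ?case by simp
    qed
    have "(\<Union>i\<in>J. cell w i) \<in> sets M"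
      using cell_measurable assms(2) fin by auto
    then show "(\<lambda>x. indicat_real (\<Union>i\<in>J. cell w i) x *\<^sub>R f x) \<in> borel_measurable M"
      using f_integrable by simp
    show "(\<lambda>x. \<Sum>i\<in>J. indicat_real (cell w i) x *\<^sub>R f x) \<in> borel_measurable M"
      using f_integrable cell_measurable assms(2)
      by (intro borel_measurable_sum borel_measurable_scaleR borel_measurable_indicator) auto
  qed
  also have "\<dots> = (\<Sum>i\<in>J. cell_mass w i)"
    unfolding cell_mass_def set_lebesgue_integral_def
    using set_integrable_f cell_measurable assms(2)
    by (intro Bochner_Integration.integral_sum) (auto simp: set_integrable_def)
  finally show ?thesis .
qed

lemma sum_cell_mass:
  assumes "admissible w"
  shows "(\<Sum>i\<in>I. cell_mass w i) = (\<integral>x. f x \<partial>M)"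
proof -
  have "AE x in M. indicat_real (\<Union>i\<in>I. cell w i) x *\<^sub>R f x = f x"
    using AE_strict_winner[OF assms] AE_space
  proof eventually_elim
    case (elim x)
    then obtain i where i: "i \<in> I" "\<forall>j\<in>I - {i}. w j * c j x < w i * c i x" by auto
    then have "x \<in> cell w i"
      using elim(2) cell_strict_winner[OF i(1) i(1), of w x] by simp
    then have "x \<in> (\<Union>i\<in>I. cell w i)" using i(1) by auto
    then show ?case by simp
  qed
  moreover have "(\<Union>i\<in>I. cell w i) \<in> sets M"
    using finite_I cell_measurable by auto
  ultimately have "(LINT x:(\<Union>i\<in>I. cell w i)|M. f x) = (\<integral>x. f x \<partial>M)"
    unfolding set_lebesgue_integral_def using f_integrable
    by (intro integral_cong_AE) auto
  then show ?thesis
    using cell_mass_UN[OF assms order.refl] by simp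
qed

text \<open>
  Away from ties, the strict inequalities that put a point into its cell persist under small changes
  of the weights. So the indicators of the cells converge almost everywhere, and dominated
  convergence applies.
\<close>

lemma cell_mass_tendsto:
  assumes "admissible w" "i \<in> I" and lim: "\<And>j. j \<in> I \<Longrightarrow> (\<lambda>n. W n j) \<longlonglongrightarrow> w j"
  shows "(\<lambda>n. cell_mass (W n) i) \<longlonglongrightarrow> cell_mass w i"
  unfolding cell_mass_def set_lebesgue_integral_def
proof (rule integral_dominated_convergence[where w="\<lambda>x. \<bar>f x\<bar>"])
  show "AE x in M. (\<lambda>n. indicat_real (cell (W n) i) x *\<^sub>R f x) \<longlonglongrightarrow> indicat_real (cell w i) x *\<^sub>R f x"
    using AE_strict_winner[OF assms(1)]
  proof eventually_elim
    case (elim x)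
    then obtain a where a: "a \<in> I" "\<And>j. j \<in> I - {a} \<Longrightarrow> w j * c j x < w a * c a x" by auto
    have "\<forall>\<^sub>F n in sequentially. \<forall>j\<in>I - {a}. W n j * c j x < W n a * c a x"
    proof (intro eventually_ball_finite ballI)
      fix j assume j: "j \<in> I - {a}"
      have "(\<lambda>n. W n a * c a x - W n j * c j x) \<longlonglongrightarrow> w a * c a x - w j * c j x"
        using lim a j by (intro tendsto_intros) auto
      from order_tendstoD(1)[OF this, of 0] a(2)[OF j]
      show "\<forall>\<^sub>F n in sequentially. W n j * c j x < W n a * c a x" by simp
    qed (use finite_I in auto)
    then have "\<forall>\<^sub>F n in sequentially. indicat_real (cell (W n) i) x *\<^sub>R f x = indicat_real (cell w i) x *\<^sub>R f x"
    proof eventually_elim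
      case (elim n)
      then show ?case
        using cell_strict_winner[OF a(1) assms(2), of w x] cell_strict_winner[OF a(1) assms(2), of "W n" x] a(2)
        by (simp add: indicator_def)
    qed
    then show ?case by (rule tendsto_eventually)
  qed
  show "integrable M (\<lambda>x. \<bar>f x\<bar>)" using f_integrable by auto
qed (use f_integrable cell_measurable[OF assms(2)] in \<open>auto simp: indicator_def\<close>)

lemma cell_mass_mono:
  assumes "i \<in> I" "cell w i \<subseteq> cell v i"
  shows "cell_mass w i \<le> cell_mass v i"
  unfolding cell_mass_def set_lebesgue_integral_def
proof (rule integral_mono_AE)
  show "AE x in M. indicat_real (cell w i) x *\<^sub>R f x \<le> indicat_real (cell v i) x *\<^sub>R f x"
    using f_nonneg by eventually_elim (use assms in \<open>auto simp: indicator_def\<close>)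
qed (use set_integrable_f cell_measurable[OF assms(1)] in \<open>auto simp: set_integrable_def\<close>)

lemma cell_mass_empty: "cell w i = {} \<Longrightarrow> cell_mass w i = 0"
  unfolding cell_mass_def set_lebesgue_integral_def by simp

text \<open>
  The extremal argument: weights with maximal sum among those normalized by \<open>w k = 1\<close> for which no
  cell other than \<open>k\<close> exceeds its prescribed mass. Total mass is conserved, so the equality for cell
  \<open>k\<close> follows from the others.
\<close>

lemma ex_weights:
  assumes bounds: "0 < \<alpha>" "\<And>i x. i \<in> I \<Longrightarrow> x \<in> space M \<Longrightarrow> \<alpha> \<le> c i x \<and> c i x \<le> \<beta>"
    and g: "\<And>i. i \<in> I \<Longrightarrow> 0 < g i" and total: "(\<integral>x. f x \<partial>M) = (\<Sum>i\<in>I. g i)"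
    and "I \<noteq> {}"
  shows "\<exists>w. (\<forall>i\<in>I. 0 < w i) \<and> (\<forall>i\<in>I. cell_mass w i = g i)"
proof -
  obtain k where k: "k \<in> I" using \<open>I \<noteq> {}\<close> by auto
  \<comment> \<open>A weight of at least \<open>R\<close> exceeds the function of index \<open>k\<close> everywhere, as \<open>R * \<alpha> > \<beta>\<close>.\<close>
  define R where "R = (\<bar>\<beta>\<bar> + 1) / \<alpha>"
  have R: "0 < R" using bounds(1) by (simp add: R_def)
  \<comment> \<open>Weights outside \<open>I\<close> are set to 0 so that the set of weights is a product of compact sets.\<close>
  define B where "B = (\<lambda>i. if i = k then {1} else if i \<in> I then {0..R} else {0::real})"
  define K where "K = Pi\<^sub>E UNIV B"
  define S where "S = {w \<in> K. \<forall>i\<in>I - {k}. cell_mass w i \<le> g i}"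
  have K_iff: "w \<in> K \<longleftrightarrow> w k = 1 \<and> (\<forall>i\<in>I - {k}. 0 \<le> w i \<and> w i \<le> R) \<and> (\<forall>i. i \<notin> I \<longrightarrow> w i = 0)" for w
    using k unfolding K_def B_def by (auto simp: PiE_iff split: if_splits)
  have adm: "admissible w" if "w \<in> K" for w
    using that k unfolding K_iff admissible_def by (metis Diff_iff singletonD zero_less_one zero_le_one)
  have "compact K"
    unfolding K_def compactin_euclidean_iff[symmetric] euclidean_product_topology[symmetric]
    by (subst compactin_PiE) (auto simp: B_def)
  have cont: "continuous_on K (\<lambda>w. cell_mass w i)" if "i \<in> I" for i
  proof (rule continuous_on_sequentiallyI)
    fix u a assume ua: "\<forall>n. u n \<in> K" "a \<in> K" "u \<longlonglongrightarrow> a"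
    show "(\<lambda>n. cell_mass (u n) i) \<longlonglongrightarrow> cell_mass a i"
    proof (rule cell_mass_tendsto)
      show "(\<lambda>n. u n j) \<longlonglongrightarrow> a j" for j
        using ua(3) continuous_on_tendsto_compose[OF continuous_on_product_coordinates[of j] ua(3)] by auto
    qed (use ua adm that in auto)
  qed
  have "closed S"
  proof -
    have "closed K" using \<open>compact K\<close> compact_imp_closed by auto
    have "closed {w \<in> K. cell_mass w i \<le> g i}" if "i \<in> I" for i
      using continuous_closed_preimage[OF cont[OF that] \<open>closed K\<close>, of "{..g i}"]
      by (simp add: Int_def vimage_def)
    moreover have "S = K \<inter> (\<Inter>i\<in>I - {k}. {w \<in> K. cell_mass w i \<le> g i})"
      unfolding S_def by auto
    ultimately show ?thesis using \<open>closed K\<close> by (auto intro!: closed_Int closed_INT)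
  qed
  have "S \<subseteq> K" by (auto simp: S_def)
  then have "compact S"
    using \<open>compact K\<close> \<open>closed S\<close> by (metis compact_Int_closed inf.absorb_iff2)
  moreover have "S \<noteq> {}"
  proof -
    \<comment> \<open>With all other weights 0, cell \<open>k\<close> is everything.\<close>
    define w0 where "w0 = (\<lambda>i. if i = k then 1 else 0::real)"
    have "w0 \<in> K" using k R by (auto simp: K_iff w0_def)
    moreover have "cell w0 i = {}" if "i \<in> I - {k}" for i
      using that k c_pos[OF k] unfolding cell_def w0_def by (auto simp: not_le intro!: bexI[of _ k])
    ultimately have "w0 \<in> S"
      using cell_mass_empty g by (auto simp: S_def intro: less_imp_le)
    then show ?thesis by auto
  qed
  moreover have "continuous_on S (\<lambda>w. \<Sum>i\<in>I. w i)"
    by (intro continuous_on_sum continuous_on_subset[OF continuous_on_product_coordinates]) auto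
  ultimately obtain w where w: "w \<in> S" and max: "\<And>v. v \<in> S \<Longrightarrow> (\<Sum>i\<in>I. v i) \<le> (\<Sum>i\<in>I. w i)"
    using continuous_attains_sup[of S "\<lambda>w. \<Sum>i\<in>I. w i"] by blast
  have wK: "w \<in> K" and w_le: "\<And>i. i \<in> I - {k} \<Longrightarrow> cell_mass w i \<le> g i" using w by (auto simp: S_def)
  have total_w: "(\<Sum>i\<in>I. cell_mass w i) = (\<Sum>i\<in>I. g i)"
    using sum_cell_mass[OF adm[OF wK]] total by simp
  have split: "(\<Sum>i\<in>I. h i) = h k + (\<Sum>i\<in>I - {k}. h i)" for h :: "'i \<Rightarrow> real"
    using finite_I k by (rule sum.remove)
  \<comment> \<open>The upper bound \<open>R\<close> is never active, so weights can be increased: otherwise cell \<open>k\<close> would be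
    empty and the other cells would have to carry the whole mass.\<close>
  have less_R: "w i < R" if i: "i \<in> I - {k}" for i
  proof (rule ccontr)
    assume "\<not> w i < R"
    then have "w k * c k x < w i * c i x" if x: "x \<in> space M" for x
    proof -
      have "w k * c k x < R * \<alpha>"
        using wK bounds(1) bounds(2)[OF k x] by (auto simp: K_iff R_def)
      also have "\<dots> \<le> w i * c i x"
        using \<open>\<not> w i < R\<close> bounds(1) bounds(2)[OF _ x, of i] i R by (intro mult_mono) auto
      finally show ?thesis .
    qed
    then have "cell w k = {}" using i unfolding cell_def by (force simp: not_le)
    then have "(\<Sum>i\<in>I. cell_mass w i) \<le> (\<Sum>i\<in>I - {k}. g i)"
      unfolding split[of "cell_mass w"] cell_mass_empty[OF \<open>cell w k = {}\<close>]
      using sum_mono[OF w_le, of "I - {k}" "\<lambda>i. i"] by simp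
    then show False using total_w split[of g] g[OF k] by simp
  qed
  have eq: "cell_mass w i = g i" if i: "i \<in> I - {k}" for i
  proof (rule ccontr)
    assume "cell_mass w i \<noteq> g i"
    then have lt: "cell_mass w i < g i" using w_le[OF i] by simp
    define W where "W = (\<lambda>n. w(i := w i + 1 / real (Suc n)))"
    have lim: "(\<lambda>n. W n j) \<longlonglongrightarrow> w j" for j
      using LIMSEQ_inverse_real_of_nat_add[of "w i"]
      by (cases "j = i") (auto simp: W_def inverse_eq_divide)
    have "\<forall>\<^sub>F n in sequentially. cell_mass (W n) i < g i"
      using order_tendstoD(2)[OF cell_mass_tendsto[OF adm[OF wK] _ lim] lt] i by auto
    moreover have "\<forall>\<^sub>F n in sequentially. W n i < R"
      using order_tendstoD(2)[OF lim less_R[OF i]] .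
    ultimately have "\<forall>\<^sub>F n in sequentially. cell_mass (W n) i < g i \<and> W n i < R"
      by eventually_elim simp
    then obtain n where n: "cell_mass (W n) i < g i" "W n i < R"
      using eventually_happens'[OF sequentially_bot] by blast
    have bigger: "w j \<le> W n j" for j by (simp add: W_def)
    have "cell_mass (W n) j \<le> g j" if j: "j \<in> I - {k}" for j
    proof (cases "j = i")
      case False
      have "cell (W n) j \<subseteq> cell w j"
      proof
        fix x assume x: "x \<in> cell (W n) j"
        have "w l * c l x \<le> w j * c j x" if l: "l \<in> I" for l
        proof -
          have "w l * c l x \<le> W n l * c l x"
            using bigger c_pos[OF l, of x] x by (intro mult_right_mono) (auto simp: cell_def)
          also have "\<dots> \<le> W n j * c j x" using x l by (auto simp: cell_def)
          also have "\<dots> = w j * c j x" using False by (simp add: W_def)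
          finally show ?thesis .
        qed
        then show "x \<in> cell w j" using x by (auto simp: cell_def)
      qed
      then show ?thesis using cell_mass_mono[of j "W n" w] w_le[OF j] j by auto
    qed (use n in simp)
    moreover have "W n \<in> K"
      using wK n(2) i unfolding K_iff W_def by (auto intro!: add_nonneg_nonneg)
    ultimately have "W n \<in> S" by (auto simp: S_def)
    moreover have "(\<Sum>i\<in>I. w i) < (\<Sum>i\<in>I. W n i)"
      using finite_I i bigger by (intro sum_strict_mono_ex1) (auto simp: W_def intro!: bexI[of _ i])
    ultimately show False using max by fastforce
  qed
  have "cell_mass w k = g k"
    using total_w split[of g] split[of "cell_mass w"] sum.cong[OF refl eq, of "I - {k}"] by auto
  then have mass: "cell_mass w i = g i" if "i \<in> I" for i using eq that by (cases "i = k") auto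
  have "0 < w i" if i: "i \<in> I" for i
  proof (rule ccontr)
    assume "\<not> 0 < w i"
    then have "w i = 0" using wK i unfolding K_iff by (cases "i = k") force+
    then have "cell w i = {}"
      using k c_pos[OF k] wK unfolding cell_def K_iff by (auto simp: not_le intro!: bexI[of _ k])
    then show False using mass[OF i] g[OF i] by (simp add: cell_mass_empty)
  qed
  then show ?thesis using mass by blast
qed

end

section \<open>Null sets of surface measure\<close>

lemma borel_measurable_surface_measure:
  "h \<in> borel_measurable borel \<Longrightarrow> h \<in> borel_measurable (surface_measure :: (real^'n) measure)"
  unfolding surface_measure_def
  by (intro measurable_completion)
     (simp add: measurable_restrict_space1 cong: measurable_cong_sets[OF sets_sphere_borel_measure refl])

lemma space_surface_measure [simp]: "space surface_measure = sphere (0 :: real^'n) 1"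
  unfolding surface_measure_def
  using sets_eq_imp_space_eq[OF sets_sphere_borel_measure] by (simp add: space_restrict_space)

lemma sets_surface_measureI:
  fixes A :: "(real^'n) set"
  assumes "A \<in> sets borel" "A \<subseteq> sphere 0 1"
  shows "A \<in> sets surface_measure"
  unfolding surface_measure_def using assms
  by (intro sets_completionI_sets) (auto simp: sets_sphere_borel_measure sets_restrict_space_iff)

text \<open>Negligibility of the cone, unlike its volume, can be proved without checking that the cone is Borel.\<close>

lemma AE_surface_measureI:
  fixes A :: "(real^'n) set"
  assumes "A \<in> sets borel" "negligible {r *\<^sub>R x | r x. 0 < r \<and> r < 1 \<and> x \<in> sphere 0 1 \<inter> A}"
  shows "AE x in surface_measure. x \<notin> A"
proof -
  let ?C = "{r *\<^sub>R x | r x. 0 < r \<and> r < 1 \<and> x \<in> sphere 0 1 \<inter> A}"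
  have A: "sphere 0 1 \<inter> A \<in> sets borel" using assms(1) by auto
  have "emeasure lborel ?C = 0"
  proof (cases "?C \<in> sets lborel")
    case True
    have "emeasure lborel ?C = emeasure lebesgue ?C" using True by simp
    also have "\<dots> = 0" using assms(2) by (auto simp: negligible_iff_null_sets)
    finally show ?thesis .
  qed (simp add: emeasure_notin_sets)
  then have "emeasure sphere_borel_measure (sphere 0 1 \<inter> A) = 0"
    by (subst emeasure_sphere_borel_measure[OF A]) auto
  then have "sphere 0 1 \<inter> A \<in> null_sets sphere_borel_measure"
    using A by (auto simp: sets_sphere_borel_measure sets_restrict_space_iff intro!: null_setsI)
  then have "AE x in sphere_borel_measure. x \<notin> sphere 0 1 \<inter> A"
    by (rule AE_not_in)
  then have "AE x in surface_measure. x \<notin> sphere 0 1 \<inter> A"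
    unfolding surface_measure_def by (rule AE_completion)
  then show ?thesis using AE_space by eventually_elim simp
qed

text \<open>
  The set is the boundary of the convex cone where \<open>v \<bullet> y - s * norm y\<close> is nonnegative. If \<open>v\<close> is in
  the interior of that cone, every ray from \<open>v\<close> leaves the cone only once, by concavity. Otherwise,
  by the Cauchy-Schwarz inequality, the set lies in the line spanned by \<open>v\<close>, which is negligible in
  dimension at least two.
\<close>

lemma negligible_circular_cone:
  fixes v :: "real^'n"
  assumes n: "2 \<le> CARD('n)" and v: "v \<noteq> 0" and s: "0 \<le> s"
  shows "negligible {y. v \<bullet> y = s * norm y}"
proof (cases "s < norm v")
  case True
  let ?q = "\<lambda>y. v \<bullet> y - s * norm y"
  show ?thesis
  proof (rule starlike_negligible_strong[where a = v])
    show "closed {y. v \<bullet> y = s * norm y}"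
      by (intro closed_Collect_eq continuous_intros)
    fix t :: real and x assume t: "0 \<le> t" "t < 1" "v + x \<in> {y. v \<bullet> y = s * norm y}"
    have "?q v = norm v * (norm v - s)"
      by (simp add: power2_norm_eq_inner[symmetric] power2_eq_square algebra_simps)
    then have pos: "0 < ?q v" using True v by simp
    have split: "v + t *\<^sub>R x = (1 - t) *\<^sub>R v + t *\<^sub>R (v + x)" by (simp add: algebra_simps)
    have "norm (v + t *\<^sub>R x) \<le> (1 - t) * norm v + t * norm (v + x)"
      unfolding split using norm_triangle_ineq[of "(1 - t) *\<^sub>R v" "t *\<^sub>R (v + x)"] t(1,2) by simp
    then have "s * norm (v + t *\<^sub>R x) \<le> s * ((1 - t) * norm v + t * norm (v + x))"
      using s by (rule mult_left_mono)
    moreover have "v \<bullet> (v + t *\<^sub>R x) = (1 - t) * (v \<bullet> v) + t * (v \<bullet> (v + x))"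
      unfolding split by (simp only: inner_add_right inner_scaleR_right)
    ultimately have "(1 - t) * ?q v + t * ?q (v + x) \<le> ?q (v + t *\<^sub>R x)"
      by (simp add: algebra_simps)
    moreover have "?q (v + x) = 0" using t(3) by simp
    ultimately have "0 < ?q (v + t *\<^sub>R x)"
      using mult_pos_pos[of "1 - t", OF _ pos] t(2) by simp
    then show "v + t *\<^sub>R x \<notin> {y. v \<bullet> y = s * norm y}" by simp
  qed
next
  case False
  have "{y. v \<bullet> y = s * norm y} \<subseteq> span {v}"
  proof safe
    fix y assume y: "v \<bullet> y = s * norm y"
    have "norm v * norm y \<le> v \<bullet> y" using False y by (simp add: mult_right_mono)
    then have "v \<bullet> y = norm v * norm y" using norm_cauchy_schwarz[of v y] by simp
    then have "norm v *\<^sub>R y = norm y *\<^sub>R v" by (simp add: norm_cauchy_schwarz_eq)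
    then have "inverse (norm v) *\<^sub>R norm v *\<^sub>R y = inverse (norm v) *\<^sub>R norm y *\<^sub>R v" by simp
    then have "y = (inverse (norm v) * norm y) *\<^sub>R v" using v by simp
    then show "y \<in> span {v}" by (metis span_base span_scale singletonI)
  qed
  moreover have "negligible (span {v})"
    using n v by (intro negligible_lowdim) (simp add: dim_singleton)
  ultimately show ?thesis using negligible_subset by blast
qed

lemma AE_surface_measure_hyperplane:
  fixes v :: "real^'n"
  assumes n: "2 \<le> CARD('n)" and v: "v \<noteq> 0"
  shows "AE x in surface_measure. v \<bullet> x \<noteq> s"
proof -
  have *: "AE x in surface_measure. x \<notin> {x. v \<bullet> x = s}" if v: "v \<noteq> 0" and s: "0 \<le> s" for v :: "real^'n" and s
  proof (rule AE_surface_measureI)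
    show "{x. v \<bullet> x = s} \<in> sets borel"
      by (intro borel_closed closed_hyperplane)
    show "negligible {r *\<^sub>R x |r x. 0 < r \<and> r < 1 \<and> x \<in> sphere 0 1 \<inter> {x. v \<bullet> x = s}}"
      by (rule negligible_subset[OF negligible_circular_cone[OF n v s]]) auto
  qed
  show ?thesis
  proof (cases "0 \<le> s")
    case True
    then show ?thesis using *[OF v True] by simp
  next
    case False
    then show ?thesis using *[of "- v" "- s"] v by simp
  qed
qed

text \<open>A change on a null set preserves measurability because surface measure is complete.\<close>

lemma borel_measurable_surface_cong_AE:
  fixes h h' :: "real^'n \<Rightarrow> real"
  assumes h: "h \<in> borel_measurable surface_measure" and eq: "AE x in surface_measure. h x = h' x"
  shows "h' \<in> borel_measurable surface_measure"
proof (rule measurableI)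
  fix A :: "real set" assume "A \<in> sets borel"
  then have m: "h -` A \<inter> space surface_measure \<in> sets surface_measure"
    using h by (rule measurable_sets[rotated])
  have "AE x in surface_measure. x \<in> h -` A \<inter> space surface_measure \<longleftrightarrow> x \<in> h' -` A \<inter> space surface_measure"
    using eq by eventually_elim auto
  from completion.in_sets_AE[OF this[unfolded surface_measure_def] m[unfolded surface_measure_def]]
  show "h' -` A \<inter> space surface_measure \<in> sets surface_measure" by (simp add: surface_measure_def)
qed auto

section \<open>Touching semi-ellipsoids\<close>

text \<open>
  The Lagrange condition on the sphere: the component of \<open>p\<close> orthogonal to \<open>x0\<close> would be a direction
  of increase along a great circle through \<open>x0\<close>.
\<close>

lemma inner_sphere_local_max_parallel:
  fixes p x0 :: "'a::real_inner"
  assumes x0: "norm x0 = 1" and U: "openin (top_of_set (sphere 0 1)) U" "x0 \<in> U"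
    and max: "\<And>x. x \<in> U \<Longrightarrow> p \<bullet> x \<le> p \<bullet> x0"
  shows "p = (p \<bullet> x0) *\<^sub>R x0"
proof (rule ccontr)
  define q where "q = p - (p \<bullet> x0) *\<^sub>R x0"
  assume "p \<noteq> (p \<bullet> x0) *\<^sub>R x0"
  then have q: "q \<noteq> 0" by (simp add: q_def)
  define e where "e = q /\<^sub>R norm q"
  have e: "norm e = 1" using q by (simp add: e_def)
  have "x0 \<bullet> x0 = 1" using x0 by (simp add: norm_eq_1)
  then have qx: "q \<bullet> x0 = 0" by (simp add: q_def inner_diff_left)
  then have ex: "e \<bullet> x0 = 0" by (simp add: e_def)
  have "p \<bullet> q = q \<bullet> q" 
    using qx by (simp add: q_def inner_diff_left inner_diff_right inner_commute algebra_simps)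
  then have pe: "p \<bullet> e = norm q" using q
    by (simp add: e_def power2_norm_eq_inner[symmetric] power2_eq_square)
  obtain d where d: "0 < d" "\<And>x. norm x = 1 \<Longrightarrow> dist x x0 < d \<Longrightarrow> x \<in> U"
    using U unfolding openin_euclidean_subtopology_iff by auto
  define \<gamma> where "\<gamma> = (\<lambda>t. cos t *\<^sub>R x0 + sin t *\<^sub>R e)"
  have "norm (\<gamma> t) = 1" for t
  proof -
    have "\<gamma> t \<bullet> \<gamma> t = (cos t)\<^sup>2 + (sin t)\<^sup>2"
      using x0 e ex unfolding \<gamma>_def
      by (simp add: inner_add_left inner_add_right inner_commute norm_eq_1 power2_eq_square)
    then show ?thesis by (simp add: norm_eq_1)
  qed
  moreover have "isCont \<gamma> 0" unfolding \<gamma>_def by (intro continuous_intros)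
  then have "\<forall>\<^sub>F t in at 0. dist (\<gamma> t) x0 < d"
    using d(1) by (auto simp: isCont_def tendsto_iff \<gamma>_def)
  then obtain \<delta> where \<delta>: "0 < \<delta>" "\<And>t. t \<noteq> 0 \<Longrightarrow> \<bar>t\<bar> < \<delta> \<Longrightarrow> dist (\<gamma> t) x0 < d"
    by (auto simp: eventually_at)
  ultimately have "p \<bullet> \<gamma> t \<le> p \<bullet> x0" if "\<bar>t\<bar> < \<delta>" for t
    using that d(2) max by (cases "t = 0") (auto simp: \<gamma>_def)
  then have "\<forall>t. \<bar>0 - t\<bar> < \<delta> \<longrightarrow> p \<bullet> \<gamma> t \<le> p \<bullet> \<gamma> 0" by (simp add: \<gamma>_def)
  moreover have "((\<lambda>t. p \<bullet> \<gamma> t) has_real_derivative norm q) (at 0)"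
    unfolding \<gamma>_def inner_add_right inner_scaleR_right
    by (auto intro!: derivative_eq_intros simp: pe)
  ultimately have "norm q = 0" using DERIV_local_max \<delta>(1) by blast
  then show False using q by simp
qed

lemma ellipsoid_denominator_bounds:
  fixes p x :: "'a::real_inner"
  assumes "0 \<le> \<kappa>" "norm p = 1" "norm x = 1"
  shows "1 - \<kappa> \<le> 1 - \<kappa> * (p \<bullet> x)" "1 - \<kappa> * (p \<bullet> x) \<le> 1 + \<kappa>"
proof -
  have "\<bar>p \<bullet> x\<bar> \<le> 1" using Cauchy_Schwarz_ineq2[of p x] assms by simp
  then have "p \<bullet> x \<le> 1" "- 1 \<le> p \<bullet> x" by auto
  from mult_left_mono[OF this(1) assms(1)] mult_left_mono[OF this(2) assms(1)]
  show "1 - \<kappa> \<le> 1 - \<kappa> * (p \<bullet> x)" "1 - \<kappa> * (p \<bullet> x) \<le> 1 + \<kappa>" by auto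
qed

text \<open>
  Reciprocals of semi-ellipsoids are affine in \<open>x\<close>. With \<open>s = 1 / a\<close> and \<open>t = 1 / b\<close>, contact from one
  side at \<open>x0\<close> makes \<open>s p - t q\<close> a multiple \<open>\<mu> x0\<close>, with \<open>s - t = \<kappa> \<mu>\<close> because the values agree. Comparing the
  two factorizations of \<open>s\<^sup>2 - t\<^sup>2\<close>, as \<open>(s p - t q) \<bullet> (s p + t q)\<close> and as \<open>(s - t) (s + t)\<close>, gives
  \<open>\<mu> (s (p \<bullet> x0 - \<kappa>) + t (q \<bullet> x0 - \<kappa>)) = 0\<close>.
  Here both summands in the bracket are nonnegative by the condition on the angles, so either \<open>\<mu> = 0\<close>,
  and then \<open>p = q\<close>, or both vanish. In the latter case \<open>\<mu> = \<kappa> (s - t) = \<kappa>\<^sup>2 \<mu>\<close>, and \<open>\<mu> = 0\<close> again.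
\<close>

lemma touching_ellipsoids_equal:
  fixes x0 p q :: "'a::real_inner"
  assumes \<kappa>: "0 < \<kappa>" "\<kappa> < 1" and unit: "norm x0 = 1" "norm p = 1" "norm q = 1"
    and pos: "0 < a" "0 < b" and angle: "\<kappa> \<le> p \<bullet> x0" "\<kappa> \<le> q \<bullet> x0"
    and U: "openin (top_of_set (sphere 0 1)) U" "x0 \<in> U"
    and le: "\<And>x. x \<in> U \<Longrightarrow> a / (1 - \<kappa> * (p \<bullet> x)) \<le> b / (1 - \<kappa> * (q \<bullet> x))"
    and eq: "a / (1 - \<kappa> * (p \<bullet> x0)) = b / (1 - \<kappa> * (q \<bullet> x0))"
  shows "p = q"
proof -
  define s t where "s = 1 / a" and "t = 1 / b"
  have st: "0 < s" "0 < t" using pos by (auto simp: s_def t_def)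
  have denom: "0 < 1 - \<kappa> * (r \<bullet> x)" if "norm r = 1" "norm x = 1" for r x :: 'a
    using ellipsoid_denominator_bounds(1)[OF less_imp_le[OF \<kappa>(1)] that] \<kappa>(2) by linarith
  have Usph: "norm x = 1" if "x \<in> U" for x
    using U(1) that openin_imp_subset by fastforce
  have recip_le: "t * (1 - \<kappa> * (q \<bullet> x)) \<le> s * (1 - \<kappa> * (p \<bullet> x))" if "x \<in> U" for x
    using le[OF that] denom[OF unit(2) Usph[OF that]] denom[OF unit(3) Usph[OF that]] pos
    by (simp add: s_def t_def field_simps)
  have recip_eq: "t * (1 - \<kappa> * (q \<bullet> x0)) = s * (1 - \<kappa> * (p \<bullet> x0))"
    using eq denom[OF unit(2,1)] denom[OF unit(3,1)] pos
    by (simp add: s_def t_def field_simps)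
  define \<mu> where "\<mu> = (s *\<^sub>R p - t *\<^sub>R q) \<bullet> x0"
  have diff: "\<kappa> * ((s *\<^sub>R p - t *\<^sub>R q) \<bullet> x0) = s - t"
    using recip_eq by (simp add: inner_diff_left algebra_simps)
  have "s *\<^sub>R p - t *\<^sub>R q = \<mu> *\<^sub>R x0"
    unfolding \<mu>_def
  proof (rule inner_sphere_local_max_parallel[OF unit(1) U])
    fix x assume "x \<in> U"
    then have "\<kappa> * ((s *\<^sub>R p - t *\<^sub>R q) \<bullet> x) \<le> \<kappa> * ((s *\<^sub>R p - t *\<^sub>R q) \<bullet> x0)"
      unfolding diff using recip_le by (auto simp: inner_diff_left algebra_simps)
    then show "(s *\<^sub>R p - t *\<^sub>R q) \<bullet> x \<le> (s *\<^sub>R p - t *\<^sub>R q) \<bullet> x0"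
      using \<kappa>(1) by simp
  qed
  then have normal: "s *\<^sub>R p - t *\<^sub>R q = \<mu> *\<^sub>R x0" .
  have "s\<^sup>2 - t\<^sup>2 = (s *\<^sub>R p - t *\<^sub>R q) \<bullet> (s *\<^sub>R p + t *\<^sub>R q)"
    using unit
    by (simp add: inner_diff_left inner_add_right norm_eq_1 power2_eq_square)
       (simp add: inner_commute algebra_simps)
  also have "\<dots> = \<mu> * (s * (p \<bullet> x0) + t * (q \<bullet> x0))"
    unfolding normal by (simp add: inner_add_right inner_commute algebra_simps)
  finally have "(s - t) * (s + t) = \<mu> * (s * (p \<bullet> x0) + t * (q \<bullet> x0))"
    by (simp add: power2_eq_square algebra_simps)
  moreover have "s - t = \<kappa> * \<mu>" unfolding \<mu>_def diff ..
  ultimately have prod: "\<mu> * (s * (p \<bullet> x0 - \<kappa>) + t * (q \<bullet> x0 - \<kappa>)) = 0"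
    by (simp add: algebra_simps)
  have "\<mu> = 0"
  proof (rule ccontr)
    assume nz: "\<mu> \<noteq> 0"
    have "0 \<le> s * (p \<bullet> x0 - \<kappa>)" "0 \<le> t * (q \<bullet> x0 - \<kappa>)" using st angle by auto
    then have "p \<bullet> x0 = \<kappa>" "q \<bullet> x0 = \<kappa>"
      using prod nz st by (auto simp: add_nonneg_eq_0_iff)
    then have "\<mu> = \<kappa> * (s - t)" by (simp add: \<mu>_def inner_diff_left algebra_simps)
    then have "\<mu> = \<kappa>\<^sup>2 * \<mu>" unfolding \<open>s - t = \<kappa> * \<mu>\<close> by (simp add: power2_eq_square)
    then have "\<kappa>\<^sup>2 = 1" using nz by simp
    then show False using \<kappa> by (simp add: power2_eq_1_iff)
  qed
  then have "s = t" using \<open>s - t = \<kappa> * \<mu>\<close> by simp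
  then show ?thesis using normal \<open>\<mu> = 0\<close> st by simp
qed

section \<open>Refractors given by finitely many semi-ellipsoids\<close>

locale polyhedral_refractor =
  fixes \<kappa> :: real and \<Omega> \<Omega>s :: "(real ^ 'n) set"
    and I :: "'i set" and m :: "'i \<Rightarrow> real ^ 'n" and b :: "'i \<Rightarrow> real"
  assumes \<kappa>: "0 < \<kappa>" "\<kappa> < 1"
    and sub_sphere: "\<Omega> \<subseteq> sphere 0 1" "\<Omega>s \<subseteq> sphere 0 1"
    and finite_I: "finite I" and I_nonempty: "I \<noteq> {}"
    and m_target: "\<And>i. i \<in> I \<Longrightarrow> m i \<in> closure \<Omega>s"
    and b_pos: "\<And>i. i \<in> I \<Longrightarrow> 0 < b i"
begin

definition radius :: "real ^ 'n \<Rightarrow> real" where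
  "radius x = (MIN i\<in>I. b i / (1 - \<kappa> * (m i \<bullet> x)))"

lemma closure_sub_sphere: "closure \<Omega> \<subseteq> sphere 0 1" "closure \<Omega>s \<subseteq> sphere 0 1"
  using sub_sphere by (simp_all add: closure_minimal)

lemma norm_m: "i \<in> I \<Longrightarrow> norm (m i) = 1"
  using m_target closure_sub_sphere(2) by fastforce

lemma denominator_pos:
  assumes "i \<in> I" "x \<in> closure \<Omega>"
  shows "0 < 1 - \<kappa> * (m i \<bullet> x)"
  using ellipsoid_denominator_bounds[OF less_imp_le[OF \<kappa>(1)] norm_m[OF assms(1)], of x]
    assms(2) closure_sub_sphere(1) \<kappa>(2) by fastforce

lemma radius_le: "i \<in> I \<Longrightarrow> radius x \<le> b i / (1 - \<kappa> * (m i \<bullet> x))"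
  unfolding radius_def using finite_I by (intro Min_le) auto

lemma radius_attained:
  obtains i where "i \<in> I" "radius x = b i / (1 - \<kappa> * (m i \<bullet> x))"
proof -
  have "radius x \<in> (\<lambda>i. b i / (1 - \<kappa> * (m i \<bullet> x))) ` I"
    unfolding radius_def using finite_I I_nonempty by (intro Min_in) auto
  then show thesis using that by auto
qed

lemma b_nonzero: "i \<in> I \<Longrightarrow> b i \<noteq> 0"
  using less_imp_neq[OF b_pos] by metis

text \<open>Passing to reciprocals turns the minimum of semi-ellipsoids into a maximum of weighted affine functions.\<close>

lemma radius_eq_iff:
  assumes i: "i \<in> I" and x: "x \<in> closure \<Omega>"
  shows "radius x = b i / (1 - \<kappa> * (m i \<bullet> x)) \<longleftrightarrow>
         (\<forall>j\<in>I. 1 / b j * (1 - \<kappa> * (m j \<bullet> x)) \<le> 1 / b i * (1 - \<kappa> * (m i \<bullet> x)))"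
proof -
  have *: "b i / (1 - \<kappa> * (m i \<bullet> x)) \<le> b j / (1 - \<kappa> * (m j \<bullet> x)) \<longleftrightarrow>
           1 / b j * (1 - \<kappa> * (m j \<bullet> x)) \<le> 1 / b i * (1 - \<kappa> * (m i \<bullet> x))" if "j \<in> I" for j
    using denominator_pos[OF i x] denominator_pos[OF that x] b_pos[OF i] b_pos[OF that]
    by (simp add: field_simps)
  have "radius x = b i / (1 - \<kappa> * (m i \<bullet> x)) \<longleftrightarrow>
        (\<forall>j\<in>I. b i / (1 - \<kappa> * (m i \<bullet> x)) \<le> b j / (1 - \<kappa> * (m j \<bullet> x)))"
    using radius_le radius_attained[of x] i by (metis order_antisym)
  then show ?thesis using * by simp
qed

lemma mem_refractor_mapping:
  assumes "i \<in> I" "x \<in> closure \<Omega>" "radius x = b i / (1 - \<kappa> * (m i \<bullet> x))"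
  shows "m i \<in> refractor_mapping \<kappa> \<Omega> \<Omega>s radius x"
  using assms radius_le[OF assms(1)] m_target b_pos
  unfolding refractor_mapping_def supports_at_def semi_ellipsoid_def by blast

lemma continuous_on_radius: "continuous_on (closure \<Omega>) radius"
proof -
  have cont: "continuous_on (closure \<Omega>) (\<lambda>x. b i / (1 - \<kappa> * (m i \<bullet> x)))" if "i \<in> I" for i
    using denominator_pos[OF that] by (intro continuous_intros) (metis less_irrefl)
  have "continuous_on (closure \<Omega>) (\<lambda>x. MIN i\<in>J. b i / (1 - \<kappa> * (m i \<bullet> x)))"
    if "finite J" "J \<noteq> {}" "J \<subseteq> I" for J
    using that
  proof (induction J rule: finite_ne_induct)
    case (insert i J)
    then show ?case by (auto intro!: continuous_on_min cont)
  qed (auto intro: cont)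
  from this[OF finite_I I_nonempty order.refl] show ?thesis by (simp add: radius_def[abs_def])
qed

lemma far_field_refractor_radius: "far_field_refractor \<kappa> \<Omega> \<Omega>s radius"
  unfolding far_field_refractor_def
proof (intro conjI ballI continuous_on_radius)
  fix x assume x: "x \<in> closure \<Omega>"
  obtain i where i: "i \<in> I" "radius x = b i / (1 - \<kappa> * (m i \<bullet> x))" by (rule radius_attained)
  show "0 < radius x" using i b_pos denominator_pos[OF i(1) x] by simp
  show "\<exists>p\<in>closure \<Omega>s. \<exists>b>0. supports_at \<kappa> \<Omega> radius p b x"
    using mem_refractor_mapping[OF i(1) x i(2)] by (auto simp: refractor_mapping_def)
qed

text \<open>
  Near \<open>x0\<close> the surface coincides with the semi-ellipsoid of index \<open>a\<close>, so any other semi-ellipsoid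
  supporting it at \<open>x0\<close> touches that one, and \<open>touching_ellipsoids_equal\<close> applies.
\<close>

lemma refractor_mapping_singleton:
  assumes open_\<Omega>: "openin (top_of_set (sphere 0 1)) \<Omega>"
    and angle: "\<And>x p. x \<in> \<Omega> \<Longrightarrow> p \<in> \<Omega>s \<Longrightarrow> \<kappa> \<le> x \<bullet> p"
    and x0: "x0 \<in> \<Omega>" and a: "a \<in> I"
    and strict: "\<And>j. j \<in> I - {a} \<Longrightarrow>
      1 / b j * (1 - \<kappa> * (m j \<bullet> x0)) < 1 / b a * (1 - \<kappa> * (m a \<bullet> x0))"
  shows "refractor_mapping \<kappa> \<Omega> \<Omega>s radius x0 = {m a}"
proof -
  have cl: "x \<in> closure \<Omega>" if "x \<in> \<Omega>" for x using that closure_subset by auto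
  have angle': "\<kappa> \<le> p \<bullet> x0" if "p \<in> closure \<Omega>s" for p
  proof -
    have "closure \<Omega>s \<subseteq> {p. \<kappa> \<le> x0 \<bullet> p}"
      using angle[OF x0] by (intro closure_minimal closed_halfspace_ge) auto
    then show ?thesis using that by (auto simp: inner_commute)
  qed
  have strict_le: "\<forall>j\<in>I. 1 / b j * (1 - \<kappa> * (m j \<bullet> x)) \<le> 1 / b a * (1 - \<kappa> * (m a \<bullet> x))"
    if "\<forall>j\<in>I - {a}. 1 / b j * (1 - \<kappa> * (m j \<bullet> x)) < 1 / b a * (1 - \<kappa> * (m a \<bullet> x))" for x
    using that by (metis Diff_iff less_imp_le order.refl singletonD)
  have radius_x0: "radius x0 = b a / (1 - \<kappa> * (m a \<bullet> x0))"
    using radius_eq_iff[OF a cl[OF x0]] strict_le strict by blast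
  define V where "V = {x. \<forall>j\<in>I - {a}. 1 / b j * (1 - \<kappa> * (m j \<bullet> x)) < 1 / b a * (1 - \<kappa> * (m a \<bullet> x))}"
  have "V = (\<Inter>j\<in>I - {a}.
      {x. 1 / b j * (1 - \<kappa> * (m j \<bullet> x)) < 1 / b a * (1 - \<kappa> * (m a \<bullet> x))})"
    by (auto simp: V_def)
  then have "open V"
    using finite_I by (auto intro!: open_INT open_Collect_less continuous_intros simp: b_nonzero a)
  have radius_V: "radius x = b a / (1 - \<kappa> * (m a \<bullet> x))" if "x \<in> \<Omega> \<inter> V" for x
    using radius_eq_iff[OF a cl, of x] strict_le[of x] that unfolding V_def by blast
  have "p = m a" if p: "p \<in> refractor_mapping \<kappa> \<Omega> \<Omega>s radius x0" for p
  proof -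
    obtain d where pd: "p \<in> closure \<Omega>s" "0 < d" "\<And>x. x \<in> closure \<Omega> \<Longrightarrow> radius x \<le> d / (1 - \<kappa> * (p \<bullet> x))"
      "radius x0 = d / (1 - \<kappa> * (p \<bullet> x0))"
      using p unfolding refractor_mapping_def supports_at_def semi_ellipsoid_def by auto
    have "m a = p"
    proof (rule touching_ellipsoids_equal[OF \<kappa> _ norm_m[OF a] _ b_pos[OF a] pd(2)])
      show "norm x0 = 1" using x0 sub_sphere by auto
      show "norm p = 1" using pd(1) closure_sub_sphere by auto
      show "\<kappa> \<le> m a \<bullet> x0" "\<kappa> \<le> p \<bullet> x0" using angle' m_target[OF a] pd(1) by auto
      show "openin (top_of_set (sphere 0 1)) (\<Omega> \<inter> V)"
        using open_\<Omega> \<open>open V\<close> by (rule openin_Int_open)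
      show "x0 \<in> \<Omega> \<inter> V" using x0 strict by (simp add: V_def)
      show "b a / (1 - \<kappa> * (m a \<bullet> x)) \<le> d / (1 - \<kappa> * (p \<bullet> x))" if "x \<in> \<Omega> \<inter> V" for x
        using pd(3)[OF cl, of x] radius_V[OF that] that by simp
      show "b a / (1 - \<kappa> * (m a \<bullet> x0)) = d / (1 - \<kappa> * (p \<bullet> x0))"
        using pd(4) radius_x0 by simp
    qed
    then show ?thesis by simp
  qed
  then show ?thesis using mem_refractor_mapping[OF a cl[OF x0] radius_x0] by blast
qed

end

section \<open>Existence of the refractor\<close>

text \<open>
  The tie set is cut out by a hyperplane with normal \<open>s p - t q\<close>. For unit vectors this vanishes only
  if \<open>s = t\<close> and \<open>p = q\<close>.
\<close>

lemma AE_ellipsoid_ties: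
  fixes p q :: "real ^ 'n"
  assumes n: "2 \<le> CARD('n)" and \<kappa>: "\<kappa> \<noteq> 0" and unit: "norm p = 1" "norm q = 1" and "p \<noteq> q"
    and st: "0 < s" "0 < t"
  shows "AE x in surface_measure. s * (1 - \<kappa> * (p \<bullet> x)) \<noteq> t * (1 - \<kappa> * (q \<bullet> x))"
proof -
  have "s *\<^sub>R p \<noteq> t *\<^sub>R q"
  proof
    assume eq: "s *\<^sub>R p = t *\<^sub>R q"
    then have "norm (s *\<^sub>R p) = norm (t *\<^sub>R q)" by simp
    then have "s = t" using unit st by simp
    then show False using eq st \<open>p \<noteq> q\<close> by simp
  qed
  then have "s *\<^sub>R p - t *\<^sub>R q \<noteq> 0" by simp
  from AE_surface_measure_hyperplane[OF n this, of "(s - t) / \<kappa>"] show ?thesis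
  proof eventually_elim
    case (elim x)
    then show ?case using \<kappa> by (auto simp: inner_diff_left field_simps)
  qed
qed

lemma AE_closure_sphere_domain:
  fixes \<Omega> :: "(real ^ 'n) set"
  assumes "sphere_domain \<Omega>" and null: "emeasure surface_measure (sphere_boundary \<Omega>) = 0"
  shows "AE x in surface_measure. x \<in> closure \<Omega> \<longrightarrow> x \<in> \<Omega>"
proof -
  have op: "openin (top_of_set (sphere 0 1)) \<Omega>" using assms(1) by (simp add: sphere_domain_def)
  have sub: "\<Omega> \<subseteq> sphere 0 1" using openin_imp_subset[OF op] .
  then have cl: "closure \<Omega> \<subseteq> sphere 0 1" by (simp add: closure_minimal)
  have "closedin (top_of_set (sphere 0 1)) (sphere_boundary \<Omega>)"
    unfolding sphere_boundary_def by (rule closedin_frontier_of)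
  then have "closed (sphere_boundary \<Omega>)" by (rule closedin_closed_trans) simp
  moreover have "sphere_boundary \<Omega> \<subseteq> sphere 0 1"
    unfolding sphere_boundary_def using frontier_of_subset_topspace[of "top_of_set (sphere 0 1)"] by simp
  ultimately have "sphere_boundary \<Omega> \<in> sets surface_measure"
    by (intro sets_surface_measureI) auto
  then have "AE x in surface_measure. x \<notin> sphere_boundary \<Omega>"
    using null by (intro AE_not_in null_setsI)
  then show ?thesis
  proof eventually_elim
    case (elim x)
    have "sphere_boundary \<Omega> = closure \<Omega> - \<Omega>"
      unfolding sphere_boundary_def frontier_of_def interior_of_openin[OF op]
      using cl sub by (simp add: closure_of_subtopology Int_absorb1 Int_absorb2)
    then show ?case using elim by auto
  qed
qed

theorem theorem7p4:
  fixes \<kappa> :: real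
    and \<Omega> \<Omega>s :: "(real ^ 'n) set"
    and N :: nat
    and m :: "nat \<Rightarrow> real ^ 'n"
    and g :: "nat \<Rightarrow> real"
    and f :: "real ^ 'n \<Rightarrow> real"
  assumes "2 \<le> CARD('n)"
    and "0 < \<kappa>" "\<kappa> < 1"
    and "sphere_domain \<Omega>" "sphere_domain \<Omega>s"
    and "emeasure surface_measure (sphere_boundary \<Omega>) = 0"
    and "\<And>x p. x \<in> \<Omega> \<Longrightarrow> p \<in> \<Omega>s \<Longrightarrow> \<kappa> \<le> x \<bullet> p"
    and "1 \<le> N"
    and "inj_on m {1..N}"
    and "\<And>i. i \<in> {1..N} \<Longrightarrow> m i \<in> closure \<Omega>s"
    and "\<And>i. i \<in> {1..N} \<Longrightarrow> 0 < g i"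
    and "set_integrable surface_measure \<Omega> f"
    and "AE x in surface_measure. x \<in> \<Omega> \<longrightarrow> 0 \<le> f x"
    and "\<And>x i. x \<in> \<Omega> \<Longrightarrow> i \<in> {1..N} \<Longrightarrow> \<kappa> \<le> x \<bullet> m i"
    and "(LINT x:closure \<Omega>|surface_measure. f x) = (\<Sum>i\<in>{1..N}. g i)"
  shows "\<exists>b :: nat \<Rightarrow> real.
    (\<forall>i\<in>{1..N}. 0 < b i) \<and>
    (let \<rho> = (\<lambda>x. MIN i\<in>{1..N}. b i / (1 - \<kappa> * (m i \<bullet> x))) in
       weak_solution \<kappa> \<Omega> \<Omega>s f (point_masses {1..N} g m) \<rho> \<and>
       (\<forall>i\<in>{1..N}. refractor_measure \<kappa> \<Omega> \<Omega>s \<rho> f {m i} = g i))"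
proof -
  let ?I = "{1..N}" and ?\<sigma> = "surface_measure :: (real ^ 'n) measure"
  define c where "c = (\<lambda>i x. 1 - \<kappa> * (m i \<bullet> x))"
  \<comment> \<open>Restricted to \<open>closure \<Omega>\<close>, the intensity is integrable on the whole sphere, so that the cells can be
    taken in the sphere.\<close>
  define f0 where "f0 = (\<lambda>x. indicat_real (closure \<Omega>) x *\<^sub>R f x)"
  have op: "openin (top_of_set (sphere 0 1)) \<Omega>"
    using assms(4) by (simp add: sphere_domain_def)
  have sub: "\<Omega> \<subseteq> sphere 0 1" "\<Omega>s \<subseteq> sphere 0 1"
    using assms(4,5) openin_imp_subset by (auto simp: sphere_domain_def)
  then have cl: "closure \<Omega> \<subseteq> sphere 0 1" "closure \<Omega>s \<subseteq> sphere 0 1"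
    by (simp_all add: closure_minimal)
  have norm_m: "norm (m i) = 1" if "i \<in> ?I" for i
    using assms(10)[OF that] cl(2) by auto
  note bdry = AE_closure_sphere_domain[OF assms(4,6)]
  have f0_AE: "AE x in ?\<sigma>. indicat_real \<Omega> x *\<^sub>R f x = f0 x"
    using bdry by eventually_elim (use closure_subset[of \<Omega>] in \<open>auto simp: f0_def indicator_def\<close>)
  have f\<Omega>: "integrable ?\<sigma> (\<lambda>x. indicat_real \<Omega> x *\<^sub>R f x)"
    using assms(12) by (simp add: set_integrable_def)
  have f0_int: "integrable ?\<sigma> f0"
    using borel_measurable_surface_cong_AE[OF borel_measurable_integrable[OF f\<Omega>] f0_AE]
    by (intro integrable_cong_AE_imp[OF f\<Omega> _ f0_AE]) auto
  have c_bounds: "1 - \<kappa> \<le> c i x \<and> c i x \<le> 1 + \<kappa>" if "i \<in> ?I" "x \<in> space ?\<sigma>" for i x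
    using ellipsoid_denominator_bounds[of \<kappa> "m i" x] norm_m that assms(2) by (simp add: c_def)
  interpret D: dominance_cells ?\<sigma> ?I c f0
  proof
    show "c i \<in> borel_measurable ?\<sigma>" for i
      unfolding c_def by (rule borel_measurable_surface_measure) measurable
    show "0 < c i x" if "i \<in> ?I" "x \<in> space ?\<sigma>" for i x
      using c_bounds[OF that] assms(3) by linarith
    show "AE x in ?\<sigma>. s * c i x \<noteq> t * c j x"
      if "i \<in> ?I" "j \<in> ?I" "i \<noteq> j" "0 < s" "0 < t" for i j s t
    proof -
      have "m i \<noteq> m j" using inj_onD[OF assms(9) _ that(1,2)] that(3) by auto
      then show ?thesis
        unfolding c_def using assms(2) that norm_m
        by (intro AE_ellipsoid_ties[OF assms(1)]) simp_all
    qed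
    show "AE x in ?\<sigma>. 0 \<le> f0 x"
      using bdry assms(13) by eventually_elim (auto simp: f0_def indicator_def)
  qed (rule finite_atLeastAtMost f0_int)+
  have total: "(\<integral>x. f0 x \<partial>?\<sigma>) = (\<Sum>i\<in>?I. g i)"
    using assms(15) by (simp add: f0_def set_lebesgue_integral_def)
  have \<kappa>_less: "0 < 1 - \<kappa>" using assms(3) by simp
  have I_nonempty: "?I \<noteq> {}" using assms(8) by auto
  obtain w where w: "\<And>i. i \<in> ?I \<Longrightarrow> 0 < w i" "\<And>i. i \<in> ?I \<Longrightarrow> D.cell_mass w i = g i"
    using D.ex_weights[OF \<kappa>_less c_bounds assms(11) total I_nonempty] by blast
  have adm: "D.admissible w"
    unfolding D.admissible_def using w(1) I_nonempty by (blast intro: less_imp_le)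
  define b where "b = (\<lambda>i. 1 / w i)"
  have b_pos: "0 < b i" if "i \<in> ?I" for i using w(1)[OF that] by (simp add: b_def)
  interpret P: polyhedral_refractor \<kappa> \<Omega> \<Omega>s ?I m b
    by unfold_locales (rule assms(2,3,10) sub finite_atLeastAtMost I_nonempty b_pos; assumption)+
  have w_eq: "1 / b i = w i" for i by (simp add: b_def)
  \<comment> \<open>The exceptional points are those of the boundary of \<open>\<Omega>\<close> and the ties.\<close>
  have preimage_AE: "AE x in ?\<sigma>. x \<in> closure \<Omega> \<inter> (\<Union>i\<in>{i \<in> ?I. m i \<in> F}. D.cell w i) \<longleftrightarrow>
      x \<in> refractor_preimage \<kappa> \<Omega> \<Omega>s P.radius F" for F
    using bdry D.AE_strict_winner[OF adm] AE_space
  proof eventually_elim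
    case (elim x)
    then obtain a where a: "a \<in> ?I" "\<And>j. j \<in> ?I - {a} \<Longrightarrow> w j * c j x < w a * c a x" by auto
    show ?case
    proof (cases "x \<in> closure \<Omega>")
      case True
      then have x: "x \<in> \<Omega>" using elim(1) by simp
      have "refractor_mapping \<kappa> \<Omega> \<Omega>s P.radius x = {m a}"
        using P.refractor_mapping_singleton[OF op assms(7) x a(1)] a(2) by (simp add: w_eq c_def)
      moreover have "x \<in> D.cell w i \<longleftrightarrow> i = a" if "i \<in> ?I" for i
        using D.cell_strict_winner[OF a(1) that a(2)] elim(3) by simp
      ultimately show ?thesis using True a(1) by (auto simp: refractor_preimage_def)
    qed (auto simp: refractor_preimage_def)
  qed
  have cells_sets: "(\<Union>i\<in>{i \<in> ?I. m i \<in> F}. D.cell w i) \<in> sets ?\<sigma>" for F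
    using D.cell_measurable by auto
  have preimage_sets: "refractor_preimage \<kappa> \<Omega> \<Omega>s P.radius F \<in> sets ?\<sigma>" for F
  proof -
    have "closure \<Omega> \<inter> (\<Union>i\<in>{i \<in> ?I. m i \<in> F}. D.cell w i) \<in> sets ?\<sigma>"
      using cl(1) by (intro sets.Int cells_sets sets_surface_measureI) auto
    moreover have "refractor_preimage \<kappa> \<Omega> \<Omega>s P.radius F \<subseteq> space ?\<sigma>"
      using cl(1) by (auto simp: refractor_preimage_def)
    ultimately show ?thesis
      using completion.in_sets_AE[OF preimage_AE[unfolded surface_measure_def]]
      by (simp add: surface_measure_def)
  qed
  have measure_eq: "refractor_measure \<kappa> \<Omega> \<Omega>s P.radius f F = (\<Sum>i\<in>{i \<in> ?I. m i \<in> F}. g i)" for F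
  proof -
    let ?U = "\<Union>i\<in>{i \<in> ?I. m i \<in> F}. D.cell w i"
    let ?V = "refractor_preimage \<kappa> \<Omega> \<Omega>s P.radius F"
    have eq: "AE x in ?\<sigma>. indicat_real ?U x *\<^sub>R f0 x = indicat_real ?V x *\<^sub>R f x"
      using preimage_AE[of F]
    proof eventually_elim
      case (elim x)
      have "?V \<subseteq> closure \<Omega>" by (auto simp: refractor_preimage_def)
      then show ?case using elim by (cases "x \<in> closure \<Omega>") (auto simp: f0_def indicator_def)
    qed
    have meas: "(\<lambda>x. indicat_real ?U x *\<^sub>R f0 x) \<in> borel_measurable ?\<sigma>"
      using D.set_integrable_f[OF cells_sets] by (auto simp: set_integrable_def)
    have "refractor_measure \<kappa> \<Omega> \<Omega>s P.radius f F = (LINT x:?U|?\<sigma>. f0 x)"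
      unfolding refractor_measure_def set_lebesgue_integral_def
      using integral_cong_AE[OF meas borel_measurable_surface_cong_AE[OF meas eq] eq] by simp
    also have "\<dots> = (\<Sum>i\<in>{i \<in> ?I. m i \<in> F}. D.cell_mass w i)"
      by (rule D.cell_mass_UN[OF adm]) auto
    also have "\<dots> = (\<Sum>i\<in>{i \<in> ?I. m i \<in> F}. g i)"
      using w(2) by (intro sum.cong) auto
    finally show ?thesis .
  qed
  have "weak_solution \<kappa> \<Omega> \<Omega>s f (point_masses ?I g m) P.radius"
    unfolding weak_solution_def
  proof (intro conjI ballI impI P.far_field_refractor_radius preimage_sets)
    fix F :: "(real ^ 'n) set" assume F: "F \<in> sets borel"
    have "ennreal (refractor_measure \<kappa> \<Omega> \<Omega>s P.radius f F) = (\<Sum>i\<in>{i \<in> ?I. m i \<in> F}. ennreal (g i))"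
      unfolding measure_eq using assms(11) by (intro sum_ennreal[symmetric]) (auto intro: less_imp_le)
    also have "\<dots> = (\<Sum>i\<in>?I. ennreal (g i) * indicator F (m i))"
      by (intro sum.mono_neutral_cong_left) (auto simp: indicator_def)
    also have "\<dots> = emeasure (point_masses ?I g m) F"
      using F by (simp add: emeasure_point_masses)
    finally show "ennreal (refractor_measure \<kappa> \<Omega> \<Omega>s P.radius f F) = emeasure (point_masses ?I g m) F" .
  qed
  moreover have "refractor_measure \<kappa> \<Omega> \<Omega>s P.radius f {m i} = g i" if "i \<in> ?I" for i
  proof -
    have "{j \<in> ?I. m j \<in> {m i}} = {i}" using that inj_onD[OF assms(9)] by blast
    then show ?thesis unfolding measure_eq by simp
  qed
  ultimately show ?thesis
    unfolding Let_def P.radius_def[abs_def] using b_pos by (intro exI[of _ b] conjI ballI) blast+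
qed

end
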